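(* Every finite transitive permutation group of prime power degree has the EKR property; that is, if $G\leqslant\mathrm{Sym}(\Omega)$ is transitive with $|\Omega|=p^k$ for a prime $p$ and integer $k\ge0$, then every intersecting set $S\subseteq G$ satisfies $|S|\leqslant|G_\omega|$ for $\omega\in\Omega$.
   Context: For a finite permutation group $G\leqslant\mathrm{Sym}(\Omega)$, elements $x,y\in G$ intersect if some $\alpha\in\Omega$ satisfies $\alpha^{xy^{-1}}=\alpha$; a subset $S\subseteq G$ is an intersecting set if every two of its elements intersect. $G$ has the EKR property if its point stabilizers are intersecting sets of maximum possible size. *)

theory Defs
  imports "HOL-Algebra.Group_Action" "HOL-Computational_Algebra.Primes"
begin

text \<open>
  A permutation group on \<open>\<Omega>\<close> is a subgroup \<open>G\<close> of \<open>BijGroup \<Omega>\<close>, whose elements are the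
  bijections of \<open>\<Omega>\<close> extended by \<open>undefined\<close> outside \<open>\<Omega>\<close>. It acts on \<open>\<Omega>\<close> by application.
\<close>

abbreviation perm_group :: "'a set \<Rightarrow> ('a \<Rightarrow> 'a) set \<Rightarrow> ('a \<Rightarrow> 'a) monoid" where
  "perm_group \<Omega> G \<equiv> BijGroup \<Omega>\<lparr>carrier := G\<rparr>"

abbreviation transitive_perm_group :: "'a set \<Rightarrow> ('a \<Rightarrow> 'a) set \<Rightarrow> bool" where
  "transitive_perm_group \<Omega> G \<equiv>
     subgroup G (BijGroup \<Omega>) \<and> transitive_action (perm_group \<Omega> G) \<Omega> (\<lambda>g. g)"

abbreviation point_stabilizer :: "'a set \<Rightarrow> ('a \<Rightarrow> 'a) set \<Rightarrow> 'a \<Rightarrow> ('a \<Rightarrow> 'a) set" where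
  "point_stabilizer \<Omega> G \<omega> \<equiv> stabilizer (perm_group \<Omega> G) (\<lambda>g. g) \<omega>"

text \<open>
  In exponent notation permutations act on the right, so \<open>xy\<^sup>-\<^sup>1\<close> means \<open>x\<close> first and then the
  inverse of \<open>y\<close>. Multiplication in \<open>BijGroup\<close> is composition of functions acting on the left,
  hence the reversed order of the factors here.
\<close>

definition perms_intersect :: "'a set \<Rightarrow> ('a \<Rightarrow> 'a) \<Rightarrow> ('a \<Rightarrow> 'a) \<Rightarrow> bool" where
  "perms_intersect \<Omega> x y \<longleftrightarrow>
     (\<exists>\<alpha>\<in>\<Omega>. (inv\<^bsub>BijGroup \<Omega>\<^esub> y \<otimes>\<^bsub>BijGroup \<Omega>\<^esub> x) \<alpha> = \<alpha>)"

definition intersecting_set :: "'a set \<Rightarrow> ('a \<Rightarrow> 'a) set \<Rightarrow> ('a \<Rightarrow> 'a) set \<Rightarrow> bool" where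
  "intersecting_set \<Omega> G S \<longleftrightarrow> S \<subseteq> G \<and> (\<forall>x\<in>S. \<forall>y\<in>S. perms_intersect \<Omega> x y)"

text \<open>Meaningful only for finite \<open>\<Omega>\<close>, since \<open>card\<close> is \<open>0\<close> on infinite sets.\<close>

definition has_EKR_property :: "'a set \<Rightarrow> ('a \<Rightarrow> 'a) set \<Rightarrow> bool" where
  "has_EKR_property \<Omega> G \<longleftrightarrow>
     (\<forall>\<omega>\<in>\<Omega>. intersecting_set \<Omega> G (point_stabilizer \<Omega> G \<omega>) \<and>
        (\<forall>S. intersecting_set \<Omega> G S \<longrightarrow> card S \<le> card (point_stabilizer \<Omega> G \<omega>)))"

end

theory Submission
  imports Defs "HOL-Algebra.Sylow" "HOL-Algebra.Zassenhaus"
begin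

text \<open>
  A set \<open>T \<subseteq> G\<close> in which no two distinct elements agree at a point bounds every intersecting
  set \<open>S\<close> by \<open>|S| |T| \<le> |G|\<close>, because \<open>(t, s) \<mapsto> t s\<^sup>-\<^sup>1\<close> is injective on \<open>T \<times> S\<close>. It therefore
  suffices to find such a \<open>T\<close> with \<open>|T| = |\<Omega>|\<close>. As the degree is a power of \<open>p\<close>, a Sylow
  \<open>p\<close>-subgroup is still transitive. In a transitive \<open>p\<close>-group of permutations, the center \<open>Z\<close>
  acts semiregularly, and modulo the orbits of \<open>Z\<close> a suitable set exists by induction;
  multiplying a lift of it by \<open>Z\<close> yields \<open>T\<close>.
\<close>

section \<open>Centers of groups of prime power order\<close>

context group
begin

text \<open>With \<open>m_assoc\<close> and \<open>inv_mult_group\<close>, this rule and the next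
  let the simplifier normalize the group words in the commutator calculations below.\<close>

lemma inv_mult_cancel_left [simp]:
  "\<lbrakk>x \<in> carrier G; y \<in> carrier G\<rbrakk> \<Longrightarrow> inv x \<otimes> (x \<otimes> y) = y"
  by (simp add: m_assoc [symmetric])

lemma mult_inv_cancel_left [simp]:
  "\<lbrakk>x \<in> carrier G; y \<in> carrier G\<rbrakk> \<Longrightarrow> x \<otimes> (inv x \<otimes> y) = y"
  by (simp add: m_assoc [symmetric])

text \<open>Class equation: conjugacy classes have p-power size, and a class of size 1 consists of a
  central element. If \<one> were the only central element, p would divide both the group order and
  the sum over all other classes, hence 1.\<close>

lemma prime_power_order_center_nontrivial:
  assumes "prime p" "order G = p ^ n" "carrier G \<noteq> {\<one>}"
  obtains z where "z \<in> carrier G" "z \<noteq> \<one>" "\<And>g. g \<in> carrier G \<Longrightarrow> g \<otimes> z = z \<otimes> g"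
proof (rule ccontr)
  assume "\<not> thesis"
  with that have central_trivial:
    "\<And>z. z \<in> carrier G \<Longrightarrow> (\<And>g. g \<in> carrier G \<Longrightarrow> g \<otimes> z = z \<otimes> g) \<Longrightarrow> z = \<one>"
    by blast
  define \<phi> where "\<phi> = (\<lambda>g. \<lambda>h \<in> carrier G. g \<otimes> h \<otimes> inv g)"
  interpret conj: group_action G "carrier G" \<phi>
    using action_by_conjugation by (simp add: \<phi>_def)
  have fin: "finite (carrier G)"
    using assms(1,2) by (metis card_ge_0_finite order_def power_eq_0_iff prime_gt_0_nat neq0_conv)
  let ?O = "orbits G (carrier G) \<phi>"
  have finO: "finite ?O"
    using fin by (simp add: orbits_def)
  have orbit_one: "orbit G \<phi> \<one> = {\<one>}"
    unfolding orbit_def \<phi>_def using one_closed by (auto intro: exI [of _ \<one>])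
  have "p dvd card X" if "X \<in> ?O - {{\<one>}}" for X
  proof -
    from that obtain x where x: "x \<in> carrier G" "X = orbit G \<phi> x" "X \<noteq> {\<one>}"
      by (auto simp: orbits_def)
    have "card X dvd p ^ n"
      using conj.orbit_stabilizer_theorem [OF x(1)] x(2) assms(2) by (metis dvd_triv_left)
    then obtain j where j: "card X = p ^ j"
      using assms(1) divides_primepow_nat by blast
    have "j \<noteq> 0"
    proof
      assume "j = 0"
      then have "card X = 1"
        using j by simp
      then have X: "X = {x}"
        using conj.orbit_refl [OF x(1)] x(2) by (metis card_1_singletonE singletonD)
      have "g \<otimes> x = x \<otimes> g" if g: "g \<in> carrier G" for g
      proof -
        have "g \<otimes> x \<otimes> inv g = x"
          using X x g by (auto simp: orbit_def \<phi>_def)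
        then show ?thesis
          using g x(1) by (metis inv_solve_right m_closed inv_closed)
      qed
      then have "x = \<one>"
        using central_trivial x(1) by blast
      then show False
        using x X by simp
    qed
    then show ?thesis
      using j by simp
  qed
  then have rest: "p dvd (\<Sum>X \<in> ?O - {{\<one>}}. card X)"
    by (rule dvd_sum)
  have "order G = (\<Sum>X \<in> ?O. card X)"
    using conj.disjoint_sum [OF fin, of "\<lambda>_. 1 :: nat"] by (simp add: order_def)
  moreover have "{\<one>} \<in> ?O"
    using orbit_one by (force simp: orbits_def)
  ultimately have "order G = 1 + (\<Sum>X \<in> ?O - {{\<one>}}. card X)"
    using sum.remove [OF finO, of "{\<one>}" card] by simp
  moreover have "n \<noteq> 0"
    using assms(2,3) order_one_triv_iff by (cases n) auto
  then have "p dvd order G"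
    using assms(2) by simp
  ultimately have "p dvd 1"
    using rest by (metis dvd_add_left_iff)
  then show False
    using assms(1) by (metis not_prime_unit)
qed

section \<open>The center modulo a normal subgroup\<close>

text \<open>The preimage in \<open>G\<close> of the center of \<open>G Mod N\<close>.\<close>

definition relative_center :: "'a set \<Rightarrow> 'a set" where
  "relative_center N = {z \<in> carrier G. \<forall>g \<in> carrier G. inv z \<otimes> (inv g \<otimes> z \<otimes> g) \<in> N}"

lemma subset_relative_center:
  assumes "N \<lhd> G"
  shows "N \<subseteq> relative_center N"
proof
  interpret N: normal N G by fact
  fix z assume z: "z \<in> N"
  then show "z \<in> relative_center N"
    by (auto simp: relative_center_def N.inv_op_closed1 N.mem_carrier)
qed

lemma normal_relative_center:
  assumes "N \<lhd> G"
  shows "relative_center N \<lhd> G"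
proof -
  interpret N: normal N G by fact
  let ?Z = "relative_center N"
  have mult: "z \<otimes> w \<in> ?Z" if z: "z \<in> ?Z" and w: "w \<in> ?Z" for z w
    unfolding relative_center_def
  proof (intro CollectI conjI ballI)
    have c: "z \<in> carrier G" "w \<in> carrier G"
      using z w by (auto simp: relative_center_def)
    then show "z \<otimes> w \<in> carrier G" by simp
    fix g assume g: "g \<in> carrier G"
    let ?n = "inv z \<otimes> (inv g \<otimes> z \<otimes> g)"
    \<comment> \<open>Commutator identity [zw, g] = [z, g]^w [w, g]; both factors lie in
      \<open>N\<close>, the first by normality.\<close>
    have "inv w \<otimes> ?n \<otimes> w \<in> N" "inv w \<otimes> (inv g \<otimes> w \<otimes> g) \<in> N"
      using z w g by (auto simp: relative_center_def N.inv_op_closed1)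
    then have "(inv w \<otimes> ?n \<otimes> w) \<otimes> (inv w \<otimes> (inv g \<otimes> w \<otimes> g)) \<in> N"
      by simp
    then show "inv (z \<otimes> w) \<otimes> (inv g \<otimes> (z \<otimes> w) \<otimes> g) \<in> N"
      using c g by (simp add: m_assoc inv_mult_group)
  qed
  have inv: "inv z \<in> ?Z" if z: "z \<in> ?Z" for z
    unfolding relative_center_def
  proof (intro CollectI conjI ballI)
    have c: "z \<in> carrier G"
      using z by (auto simp: relative_center_def)
    then show "inv z \<in> carrier G" by simp
    fix g assume g: "g \<in> carrier G"
    \<comment> \<open>The commutator of \<open>inv z\<close> with \<open>g\<close> is the inverse of
      that of \<open>z\<close>, conjugated by \<open>z\<close>.\<close>
    have "inv (inv z \<otimes> (inv g \<otimes> z \<otimes> g)) \<in> N"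
      using z g by (auto simp: relative_center_def)
    then have "z \<otimes> inv (inv z \<otimes> (inv g \<otimes> z \<otimes> g)) \<otimes> inv z \<in> N"
      using c by (simp add: N.inv_op_closed2)
    then show "inv (inv z) \<otimes> (inv g \<otimes> inv z \<otimes> g) \<in> N"
      using c g by (simp add: m_assoc inv_mult_group)
  qed
  have conj: "g \<otimes> z \<otimes> inv g \<in> ?Z" if z: "z \<in> ?Z" and g: "g \<in> carrier G" for z g
  proof -
    have c: "z \<in> carrier G"
      using z by (auto simp: relative_center_def)
    \<comment> \<open>A conjugate of \<open>z\<close> is \<open>z\<close> times a commutator lying
      in \<open>N\<close>, so closure under products suffices.\<close>
    have "inv z \<otimes> (inv (inv g) \<otimes> z \<otimes> inv g) \<in> N"
      using z g inv_closed unfolding relative_center_def by blast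
    then have "z \<otimes> (inv z \<otimes> (inv (inv g) \<otimes> z \<otimes> inv g)) \<in> ?Z"
      using mult z subset_relative_center [OF assms] by blast
    then show ?thesis
      using c g by simp
  qed
  have "subgroup ?Z G"
    using mult inv subset_relative_center [OF assms] N.one_closed
    by (intro subgroupI) (auto simp: relative_center_def)
  then show ?thesis
    using conj by (simp add: normal_inv_iff)
qed

text \<open>The quotient by \<open>N\<close> is a nontrivial group of p-power order, so it has a
  nontrivial central coset; a representative of that coset lies in the relative center but outside
  \<open>N\<close>.\<close>

lemma relative_center_strict:
  assumes N: "N \<lhd> G" "N \<noteq> carrier G" and "prime p" "order G = p ^ n"
  shows "N \<subset> relative_center N"
proof -
  interpret N: normal N G by fact
  let ?Q = "G Mod N"
  interpret Q: group ?Q by (rule N.factorgroup_is_group)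
  have "order ?Q dvd p ^ n"
    using lagrange [OF N.is_subgroup] assms(4) by (simp add: order_def FactGroup_def) (metis dvd_triv_left)
  then obtain m where m: "order ?Q = p ^ m"
    using assms(3) divides_primepow_nat by blast
  have "carrier ?Q \<noteq> {\<one>\<^bsub>?Q\<^esub>}"
  proof
    assume triv: "carrier ?Q = {\<one>\<^bsub>?Q\<^esub>}"
    have "x \<in> N" if "x \<in> carrier G" for x
    proof -
      have "N #> x = N"
        using triv that by (auto simp: FactGroup_def RCOSETS_def)
      then show ?thesis
        using that N.is_subgroup rcos_self by blast
    qed
    then show False
      using N N.subset by blast
  qed
  from Q.prime_power_order_center_nontrivial [OF assms(3) m this]
  obtain C where C: "C \<in> carrier ?Q" "C \<noteq> \<one>\<^bsub>?Q\<^esub>"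
    and comm: "\<And>D. D \<in> carrier ?Q \<Longrightarrow> D \<otimes>\<^bsub>?Q\<^esub> C = C \<otimes>\<^bsub>?Q\<^esub> D"
    by metis
  then obtain z where z: "z \<in> carrier G" "C = N #> z"
    by (auto simp: FactGroup_def RCOSETS_def)
  have "z \<notin> N"
    using C z coset_join2 [OF _ N.is_subgroup] by auto
  moreover have "inv z \<otimes> (inv g \<otimes> z \<otimes> g) \<in> N" if g: "g \<in> carrier G" for g
  proof -
    have "N #> g \<in> carrier ?Q"
      using g by (auto simp: FactGroup_def RCOSETS_def)
    from comm [OF this] have "N #> (g \<otimes> z) = N #> (z \<otimes> g)"
      using z g by (simp add: FactGroup_def N.rcos_sum)
    \<comment> \<open>Commuting cosets give zg = n(gz) with n in \<open>N\<close>; the commutator of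
      z and g is then n conjugated by gz.\<close>
    then have "z \<otimes> g \<in> N #> (g \<otimes> z)"
      using z g N.is_subgroup rcos_self by auto
    then obtain n where n: "n \<in> N" "z \<otimes> g = n \<otimes> (g \<otimes> z)"
      by (auto simp: r_coset_def)
    have "inv (g \<otimes> z) \<otimes> n \<otimes> (g \<otimes> z) \<in> N"
      using n(1) z g by (simp add: N.inv_op_closed1)
    then have "inv z \<otimes> (inv g \<otimes> (z \<otimes> g)) \<in> N"
      using n z g N.mem_carrier by (simp add: m_assoc inv_mult_group)
    then show ?thesis
      using z g by (simp add: m_assoc)
  qed
  ultimately show ?thesis
    using subset_relative_center [OF N(1)] z by (auto simp: relative_center_def)
qed

section \<open>Sharply transitive subsets in groups of prime power order\<close>

text \<open>Being in the same left coset of \<open>H\<close> is an equivalence relation on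
  \<open>A\<close>; \<open>D\<close> takes one element from each class. Since \<open>A\<close> need
  not be a union of cosets, representatives can be kept inside a prescribed subset.\<close>

lemma left_transversal_exists:
  assumes "subgroup H G" "A \<subseteq> carrier G"
  obtains D where "D \<subseteq> A" "\<And>a. a \<in> A \<Longrightarrow> \<exists>d \<in> D. inv d \<otimes> a \<in> H"
    "\<And>c d. \<lbrakk>c \<in> D; d \<in> D; inv c \<otimes> d \<in> H\<rbrakk> \<Longrightarrow> c = d"
proof -
  interpret H: subgroup H G by fact
  define r where "r a = (SOME b. b \<in> A \<and> inv a \<otimes> b \<in> H)" for a
  have sym: "inv b \<otimes> a \<in> H" if "a \<in> A" "b \<in> A" "inv a \<otimes> b \<in> H" for a b
  proof -
    have "inv (inv a \<otimes> b) = inv b \<otimes> a"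
      using that assms(2) by (simp add: inv_mult_group subset_iff)
    then show ?thesis
      using that by (metis H.m_inv_closed)
  qed
  have trans: "inv a \<otimes> c \<in> H"
    if "a \<in> A" "b \<in> A" "c \<in> A" "inv a \<otimes> b \<in> H" "inv b \<otimes> c \<in> H" for a b c
  proof -
    have "(inv a \<otimes> b) \<otimes> (inv b \<otimes> c) = inv a \<otimes> c"
      using that assms(2) by (simp add: m_assoc subset_iff)
    then show ?thesis
      using that by (metis H.m_closed)
  qed
  have r: "r a \<in> A \<and> inv a \<otimes> r a \<in> H" if "a \<in> A" for a
    unfolding r_def
    by (rule someI [of _ a]) (use that assms(2) in \<open>simp add: subset_iff\<close>)
  have r_eq: "r a = r b" if "a \<in> A" "b \<in> A" "inv a \<otimes> b \<in> H" for a b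
  proof -
    \<comment> \<open>Equivalent elements have the same candidates, so \<open>SOME\<close> picks the
      same representative for both.\<close>
    have "(\<lambda>c. c \<in> A \<and> inv a \<otimes> c \<in> H) = (\<lambda>c. c \<in> A \<and> inv b \<otimes> c \<in> H)"
      using that sym trans by blast
    then show ?thesis
      by (simp add: r_def)
  qed
  show thesis
  proof (rule that)
    show "r ` A \<subseteq> A"
      using r by blast
    show "\<exists>d \<in> r ` A. inv d \<otimes> a \<in> H" if "a \<in> A" for a
      using r sym that by blast
    fix c d assume "c \<in> r ` A" "d \<in> r ` A" and cd: "inv c \<otimes> d \<in> H"
    then obtain a b where ab: "a \<in> A" "c = r a" "b \<in> A" "d = r b"
      by blast
    then have "inv a \<otimes> b \<in> H"
      using cd r sym trans by metis
    then show "c = d"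
      using r_eq ab by blast
  qed
qed

text \<open>
  Equivalently, \<open>T\<close> acts sharply transitively on the left cosets of \<open>H\<close>. In the induction step,
  \<open>T\<close> is the product of such a set for the subgroup generated by \<open>H\<close> and \<open>relative_center N\<close> with a
  transversal of \<open>H\<close> in that subgroup chosen inside \<open>relative_center N\<close>. Conjugation moves elements
  of \<open>relative_center N\<close> only within their cosets of \<open>N \<subseteq> H\<close>, so the transversal property
  survives it.
\<close>

lemma sharply_transitive_subset_exists:
  assumes "prime p" "order G = p ^ n" "N \<lhd> G" "N \<subseteq> H" "subgroup H G"
  shows "\<exists>T \<subseteq> carrier G. carrier G \<subseteq> T <#> H \<and>
    (\<forall>s \<in> T. \<forall>t \<in> T. \<forall>g \<in> carrier G. inv g \<otimes> (inv s \<otimes> t) \<otimes> g \<in> H \<longrightarrow> s = t)"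
  using assms(3-5)
\<comment> \<open>\<open>N\<close> grows strictly towards the whole group. \<open>H\<close> varies
  as well, since the step replaces it by \<open>?Z <#> H\<close>.\<close>
proof (induction "order G - card N" arbitrary: N H rule: less_induct)
  case less
  interpret N: normal N G by fact
  interpret H: subgroup H G by fact
  have fin: "finite (carrier G)"
    using assms(1,2) by (metis card_ge_0_finite order_def power_eq_0_iff prime_gt_0_nat neq0_conv)
  show ?case
  proof (cases "N = carrier G")
    case True
    then have "H = carrier G"
      using less.prems H.subset by blast
    then show ?thesis
      by (intro exI [of _ "{\<one>}"]) (auto simp: set_mult_def)
  next
    case False
    let ?Z = "relative_center N"
    have NZ: "N \<subset> ?Z"
      using relative_center_strict False less.prems(1) assms(1,2) by blast
    have Z: "?Z \<lhd> G"
      using normal_relative_center less.prems(1) by blast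
    interpret Z: normal ?Z G by fact
    let ?K = "?Z <#> H"
    have K: "subgroup ?K G"
      using mult_norm_subgroup Z less.prems(3) by blast
    interpret K: subgroup ?K G by fact
    have ZK: "?Z \<subseteq> ?K"
    proof
      fix z assume "z \<in> ?Z"
      then have "z \<otimes> \<one> \<in> ?K"
        unfolding set_mult_def using H.one_closed by blast
      then show "z \<in> ?K"
        using Z.mem_carrier [OF \<open>z \<in> ?Z\<close>] by simp
    qed
    have HK: "H \<subseteq> ?K"
    proof
      fix h assume "h \<in> H"
      then have "\<one> \<otimes> h \<in> ?K"
        unfolding set_mult_def using Z.one_closed by blast
      then show "h \<in> ?K"
        using H.mem_carrier [OF \<open>h \<in> H\<close>] by simp
    qed
    have "order G - card ?Z < order G - card N"
      using psubset_card_mono [OF finite_subset [OF Z.subset fin] NZ] 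
        card_mono [OF fin Z.subset] by (simp add: order_def)
    from less.hyps [OF this Z ZK K]
    obtain T where T: "T \<subseteq> carrier G" "carrier G \<subseteq> T <#> ?K"
      and T_conj: "\<And>s t g. \<lbrakk>s \<in> T; t \<in> T; g \<in> carrier G; inv g \<otimes> (inv s \<otimes> t) \<otimes> g \<in> ?K\<rbrakk> \<Longrightarrow> s = t"
      by metis
    obtain D where D: "D \<subseteq> ?Z" "\<And>a. a \<in> ?Z \<Longrightarrow> \<exists>d \<in> D. inv d \<otimes> a \<in> H"
      and D_eq: "\<And>c d. \<lbrakk>c \<in> D; d \<in> D; inv c \<otimes> d \<in> H\<rbrakk> \<Longrightarrow> c = d"
      using left_transversal_exists [OF less.prems(3) Z.subset] by blast
    have DG: "D \<subseteq> carrier G"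
      using D Z.subset by blast
    show ?thesis
    proof (intro exI [of _ "T <#> D"] conjI ballI impI)
      show "T <#> D \<subseteq> carrier G"
        using T(1) DG by (rule setmult_subset_G)
      show "carrier G \<subseteq> T <#> D <#> H"
      proof
        fix x assume "x \<in> carrier G"
        then obtain t z h where x: "x = t \<otimes> (z \<otimes> h)" "t \<in> T" "z \<in> ?Z" "h \<in> H"
          using T(2) by (auto simp: set_mult_def)
        obtain d where d: "d \<in> D" "inv d \<otimes> z \<in> H"
          using D(2) x(3) by blast
        have "x = t \<otimes> d \<otimes> (inv d \<otimes> z \<otimes> h)"
          using x d T(1) DG H.subset Z.subset by (simp add: m_assoc subset_iff)
        moreover have "inv d \<otimes> z \<otimes> h \<in> H"
          using d x by simp
        ultimately show "x \<in> T <#> D <#> H"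
          using x d by (auto simp: set_mult_def)
      qed
      fix x y g assume "x \<in> T <#> D" "y \<in> T <#> D" and g: "g \<in> carrier G"
        and H: "inv g \<otimes> (inv x \<otimes> y) \<otimes> g \<in> H"
      then obtain s c t d where xy: "x = s \<otimes> c" "y = t \<otimes> d" "s \<in> T" "t \<in> T" "c \<in> D" "d \<in> D"
        by (auto simp: set_mult_def)
      have carr: "s \<in> carrier G" "t \<in> carrier G" "c \<in> carrier G" "d \<in> carrier G"
        using xy T(1) DG by auto
      \<comment> \<open>Conjugates of \<open>c\<close> and \<open>d\<close> stay in
        \<open>?Z\<close>, hence in \<open>?K\<close>. Multiplying by them strips \<open>c\<close>
        and \<open>d\<close> from the hypothesis and leaves a statement about \<open>s\<close> and
        \<open>t\<close> modulo \<open>?K\<close>.\<close>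
      have "inv g \<otimes> c \<otimes> g \<in> ?K" "inv (inv g \<otimes> d \<otimes> g) \<in> ?K"
        using xy D(1) ZK g by (blast intro: Z.inv_op_closed1 Z.m_inv_closed)+
      then have "(inv g \<otimes> c \<otimes> g) \<otimes> (inv g \<otimes> (inv x \<otimes> y) \<otimes> g) \<otimes> inv (inv g \<otimes> d \<otimes> g) \<in> ?K"
        using H HK by blast
      then have "inv g \<otimes> (inv s \<otimes> t) \<otimes> g \<in> ?K"
        using carr g by (simp add: xy m_assoc inv_mult_group)
      then have "s = t"
        using T_conj xy g by blast
      then have H': "inv g \<otimes> (inv c \<otimes> d) \<otimes> g \<in> H"
        using H carr g by (simp add: xy m_assoc inv_mult_group)
      have "inv c \<otimes> d \<in> ?Z"
        using xy D(1) by auto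
      \<comment> \<open>For u = \<open>inv c \<otimes> d\<close> in \<open>?Z\<close>, the quotient
        of u and its conjugate by \<open>g\<close> lies in \<open>N\<close>, hence in
        \<open>H\<close>; so membership of the conjugate in \<open>H\<close> passes to u
        itself.\<close>
      then have "inv (inv c \<otimes> d) \<otimes> (inv g \<otimes> (inv c \<otimes> d) \<otimes> g) \<in> H"
        using g less.prems(2) unfolding relative_center_def by blast
      then have "(inv g \<otimes> (inv c \<otimes> d) \<otimes> g) \<otimes> inv (inv (inv c \<otimes> d) \<otimes> (inv g \<otimes> (inv c \<otimes> d) \<otimes> g)) \<in> H"
        using H' by simp
      then have "inv c \<otimes> d \<in> H"
        using carr g by (simp add: m_assoc inv_mult_group)
      then show "x = y"
        using D_eq xy \<open>s = t\<close> by blast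
    qed
  qed
qed

end

section \<open>Transitivity of a Sylow subgroup\<close>

text \<open>A Sylow p-subgroup \<open>P\<close> is transitive by comparing powers of p in the two
  orbit-stabilizer equations. The result for groups of prime power order then applies to
  \<open>P\<close> and its point stabilizer.\<close>

lemma (in transitive_action) prime_power_degree_sharply_transitive_subset:
  assumes fin: "finite (carrier G)" and "prime p" and E: "card E = p ^ k"
  obtains T where "T \<subseteq> carrier G" "card E \<le> card T"
    "\<And>s t y. \<lbrakk>s \<in> T; t \<in> T; y \<in> E; \<phi> s y = \<phi> t y\<rbrakk> \<Longrightarrow> s = t"
proof -
  interpret group G
    using group_hom group_hom.axioms(1) by blast
  have "card E \<noteq> 0"
    using assms by simp
  then have finE: "finite E"
    by (metis card.infinite)
  obtain x where x: "x \<in> E"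
    using \<open>card E \<noteq> 0\<close> by fastforce
  have ord: "order G \<noteq> 0"
    using fin one_closed by (auto simp: order_def)
  obtain a m where am: "order G = p ^ a * m" "\<not> p dvd m"
    using ord \<open>prime p\<close> by (metis multiplicity_decompose' not_prime_unit)
  obtain P where P: "subgroup P G" "card P = p ^ a"
    using sylow_thm [OF \<open>prime p\<close> is_group am(1) fin] by blast
  let ?P = "G\<lparr>carrier := P\<rparr>"
  interpret P: group_action ?P E \<phi>
    using induced_action P(1) by blast
  interpret P': group ?P
    using P.group_hom group_hom.axioms(1) by blast
  have ordP: "order ?P = p ^ a"
    using P(2) by (simp add: order_def)
  let ?H = "stabilizer ?P \<phi> x" and ?S = "stabilizer G \<phi> x"
  have H: "subgroup ?H ?P"
    using P.stabilizer_subgroup [OF x] .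
  have orbP: "card (orbit ?P \<phi> x) * card ?H = p ^ a"
    using P.orbit_stabilizer_theorem [OF x] ordP by simp
  have "orbit G \<phi> x = E"
    using unique_orbit [OF x] x element_image by (auto simp: orbit_def)
  then have orbG: "p ^ k * card ?S = p ^ a * m"
    using orbit_stabilizer_theorem [OF x] E am(1) by simp
  have "subgroup ?H (G\<lparr>carrier := ?S\<rparr>)"
  proof -
    have "?H = P \<inter> ?S"
      using subgroup.subset [OF P(1)] by (auto simp: stabilizer_def)
    then show ?thesis
      using P(1) stabilizer_subgroup [OF x]
      by (metis inf.cobounded2 subgroup_incl subgroups_Inter_pair)
  qed
  then have "card ?H dvd card ?S"
    using group.lagrange [OF subgroup.subgroup_is_group [OF stabilizer_subgroup [OF x] is_group], of ?H]
    by (simp add: order_def) (metis dvd_triv_right)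
  \<comment> \<open>With \<open>card ?H\<close> = \<open>p ^ i\<close>, this forces k + i \<le> a,
    because p does not divide \<open>m\<close>. The orbit of \<open>x\<close> under \<open>P\<close>
    has length \<open>p ^ (a - i)\<close>, so at least \<open>p ^ k\<close>.\<close>
  then have "p ^ k * card ?H dvd p ^ a * m"
    unfolding orbG [symmetric] by (rule mult_dvd_mono [OF dvd_refl])
  moreover obtain j i where ji: "card (orbit ?P \<phi> x) = p ^ j" "card ?H = p ^ i"
    using orbP \<open>prime p\<close> by (metis divides_primepow_nat dvd_triv_left dvd_triv_right)
  ultimately have "p ^ (k + i) dvd m * p ^ a"
    by (simp add: power_add mult.commute)
  moreover have "coprime (p ^ (k + i)) m"
    using am(2) \<open>prime p\<close> by (simp add: prime_imp_coprime)
  ultimately have "p ^ (k + i) dvd p ^ a"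
    by (simp add: coprime_dvd_mult_right_iff)
  then have "k + i \<le> a"
    by (rule power_dvd_imp_le) (rule prime_gt_1_nat [OF \<open>prime p\<close>])
  moreover have "j + i = a"
    using orbP prime_gt_1_nat [OF \<open>prime p\<close>] by (simp add: ji flip: power_add)
  ultimately have "card E \<le> card (orbit ?P \<phi> x)"
    using prime_gt_1_nat [OF \<open>prime p\<close>] by (simp add: E ji)
  moreover have "orbit ?P \<phi> x \<subseteq> E"
    using P.element_image x by (auto simp: orbit_def)
  ultimately have P_orbit: "orbit ?P \<phi> x = E"
    using finE by (simp add: card_seteq)
  \<comment> \<open>The induction behind the next fact starts from the trivial normal
    subgroup.\<close>
  have "{\<one>\<^bsub>?P\<^esub>} \<lhd> ?P" "{\<one>\<^bsub>?P\<^esub>} \<subseteq> ?H"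
    using P'.one_is_normal subgroup.one_closed [OF H] by auto
  from P'.sharply_transitive_subset_exists [OF \<open>prime p\<close> ordP this H]
  obtain T where T: "T \<subseteq> P" "P \<subseteq> T <#>\<^bsub>?P\<^esub> ?H"
    and T_conj: "\<And>s t g. \<lbrakk>s \<in> T; t \<in> T; g \<in> P;
      inv\<^bsub>?P\<^esub> g \<otimes>\<^bsub>?P\<^esub> (inv\<^bsub>?P\<^esub> s \<otimes>\<^bsub>?P\<^esub> t) \<otimes>\<^bsub>?P\<^esub> g \<in> ?H\<rbrakk> \<Longrightarrow> s = t"
    by simp metis
  have finP: "finite P"
    using P(1) fin finite_subset subgroup.subset by blast
  have finT: "finite T" and finH: "finite ?H"
    using finP T(1) finite_subset P.stabilizer_subset [of x] by auto
  \<comment> \<open>\<open>P\<close> is covered by the products of \<open>T\<close> and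
    \<open>?H\<close>; cancelling \<open>card ?H\<close> bounds \<open>card T\<close> from
    below.\<close>
  have "card E * card ?H = card P"
    using orbP P(2) P_orbit by simp
  also have "\<dots> \<le> card ((\<lambda>(t, h). t \<otimes> h) ` (T \<times> ?H))"
    using T(2) finT finH by (intro card_mono) (auto simp: set_mult_def)
  also have "\<dots> \<le> card T * card ?H"
    using card_image_le [of "T \<times> ?H"] finT finH by (simp add: card_cartesian_product)
  finally have "card E \<le> card T"
    using ji(2) \<open>prime p\<close> by (simp add: prime_gt_0_nat)
  moreover have "s = t" if st: "s \<in> T" "t \<in> T" and y: "y \<in> E" "\<phi> s y = \<phi> t y" for s t y
  proof -
    obtain g where g: "g \<in> P" "\<phi> g x = y"
      using P_orbit y(1) by (auto simp: orbit_def)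
    have c: "s \<in> P" "t \<in> P"
      using st T(1) by auto
    let ?u = "inv\<^bsub>?P\<^esub> s \<otimes>\<^bsub>?P\<^esub> t"
    have cl: "inv\<^bsub>?P\<^esub> s \<in> P" "inv\<^bsub>?P\<^esub> g \<in> P" "?u \<in> P" 
      using c g P'.inv_closed P'.m_closed by auto
    \<comment> \<open>Since \<open>s\<close> and \<open>t\<close> agree at \<open>y\<close>,
      \<open>?u\<close> fixes \<open>y\<close>; its conjugate by \<open>g\<close>, which carries
      \<open>x\<close> to \<open>y\<close>, therefore fixes \<open>x\<close>.\<close>
    have "\<phi> ?u y = y"
      using P.composition_rule [OF y(1), of "inv\<^bsub>?P\<^esub> s" t] P.orbit_sym_aux [of s y] c cl y by simp
    moreover have "\<phi> (inv\<^bsub>?P\<^esub> g \<otimes>\<^bsub>?P\<^esub> ?u \<otimes>\<^bsub>?P\<^esub> g) x = \<phi> (inv\<^bsub>?P\<^esub> g) (\<phi> ?u (\<phi> g x))"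
      using P.composition_rule [of _ "inv\<^bsub>?P\<^esub> g \<otimes>\<^bsub>?P\<^esub> ?u" g]
        P.composition_rule [of _ "inv\<^bsub>?P\<^esub> g" ?u] cl g x y P'.m_closed [of "inv\<^bsub>?P\<^esub> g" ?u] by simp
    moreover have "\<phi> (inv\<^bsub>?P\<^esub> g) y = x"
      using P.orbit_sym_aux [of g x] g x by simp
    ultimately have "inv\<^bsub>?P\<^esub> g \<otimes>\<^bsub>?P\<^esub> ?u \<otimes>\<^bsub>?P\<^esub> g \<in> ?H"
      using cl g P'.m_closed by (simp add: stabilizer_def)
    then show ?thesis
      using T_conj st g by blast
  qed
  ultimately show thesis
    using that T(1) subgroup.subset [OF P(1)] by blast
qed

section \<open>The bound on intersecting sets\<close>

theorem theorem1p6: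
  fixes \<Omega> :: "'a set" and G :: "('a \<Rightarrow> 'a) set" and p k :: nat
  assumes "finite \<Omega>"
    and "transitive_perm_group \<Omega> G"
    and "prime p" and "card \<Omega> = p ^ k"
  shows "has_EKR_property \<Omega> G"
  unfolding has_EKR_property_def
proof (intro ballI conjI allI impI)
  fix \<omega> assume \<omega>: "\<omega> \<in> \<Omega>"
  interpret B: group "BijGroup \<Omega>"
    by (rule group_BijGroup)
  have G: "subgroup G (BijGroup \<Omega>)"
    using assms(2) by (rule conjunct1)
  interpret transitive_action "perm_group \<Omega> G" \<Omega> "\<lambda>g. g"
    using assms(2) by (rule conjunct2)
  interpret G: group "perm_group \<Omega> G"
    using G by (rule B.subgroup_imp_group)
  have quotient_apply: "(inv\<^bsub>BijGroup \<Omega>\<^esub> y \<otimes>\<^bsub>BijGroup \<Omega>\<^esub> x) \<alpha> = \<alpha> \<longleftrightarrow> x \<alpha> = y \<alpha>"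
    if x: "x \<in> G" and y: "y \<in> G" and \<alpha>: "\<alpha> \<in> \<Omega>" for x y \<alpha>
  proof -
    have inv: "inv\<^bsub>BijGroup \<Omega>\<^esub> y \<in> G"
      using G y by (simp add: subgroup.m_inv_closed)
    \<comment> \<open>The action laws use the inverse of the subgroup, whereas
      \<open>perms_intersect\<close> uses that of the full symmetric group.\<close>
    have inv_eq: "inv\<^bsub>perm_group \<Omega> G\<^esub> y = inv\<^bsub>BijGroup \<Omega>\<^esub> y"
      using B.m_inv_consistent G y by blast
    have "(inv\<^bsub>BijGroup \<Omega>\<^esub> y \<otimes>\<^bsub>BijGroup \<Omega>\<^esub> x) \<alpha> = (inv\<^bsub>BijGroup \<Omega>\<^esub> y) (x \<alpha>)"
      using composition_rule [OF \<alpha>, of "inv\<^bsub>BijGroup \<Omega>\<^esub> y" x] inv x by simp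
    moreover have "(inv\<^bsub>BijGroup \<Omega>\<^esub> y) (y \<alpha>) = \<alpha>"
      using orbit_sym_aux [of y \<alpha>] y \<alpha> inv_eq by simp
    moreover have "inj_on (inv\<^bsub>BijGroup \<Omega>\<^esub> y) \<Omega>"
      using inj_prop inv by simp
    moreover have "x \<alpha> \<in> \<Omega>" "y \<alpha> \<in> \<Omega>"
      using element_image [OF _ \<alpha> refl] x y by simp_all
    ultimately show ?thesis
      by (metis inj_on_eq_iff)
  qed
  have intersect_iff: "perms_intersect \<Omega> x y \<longleftrightarrow> (\<exists>\<alpha> \<in> \<Omega>. x \<alpha> = y \<alpha>)" if "x \<in> G" "y \<in> G" for x y
    using quotient_apply that by (simp add: perms_intersect_def)
  show "intersecting_set \<Omega> G (point_stabilizer \<Omega> G \<omega>)"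
    using \<omega> intersect_iff by (fastforce simp: intersecting_set_def stabilizer_def)
  fix S assume S: "intersecting_set \<Omega> G S"
  have SG: "S \<subseteq> G"
    using S by (simp add: intersecting_set_def)
  \<comment> \<open>Fixing the value \<open>undefined\<close> outside \<Omega> leaves only finitely
    many bijections.\<close>
  have "finite (Bij \<Omega>)"
  proof (rule finite_subset)
    show "Bij \<Omega> \<subseteq> \<Omega> \<rightarrow>\<^sub>E \<Omega>"
      by (auto simp: PiE_def dest: Bij_imp_extensional Bij_imp_funcset)
    show "finite (\<Omega> \<rightarrow>\<^sub>E \<Omega>)"
      using assms(1) by (simp add: finite_PiE)
  qed
  then have finG: "finite G"
    using subgroup.subset [OF G] finite_subset by (auto simp: BijGroup_def)
  obtain T where T: "T \<subseteq> G" "card \<Omega> \<le> card T"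
    and T_eq: "\<And>s t \<alpha>. \<lbrakk>s \<in> T; t \<in> T; \<alpha> \<in> \<Omega>; s \<alpha> = t \<alpha>\<rbrakk> \<Longrightarrow> s = t"
    using prime_power_degree_sharply_transitive_subset [OF _ assms(3,4)] finG by auto
  let ?f = "\<lambda>(t, s). t \<otimes>\<^bsub>BijGroup \<Omega>\<^esub> inv\<^bsub>BijGroup \<Omega>\<^esub> s"
  have carr: "x \<in> carrier (BijGroup \<Omega>)" if "x \<in> G" for x
    using that subgroup.subset [OF G] by blast
  have inj: "inj_on ?f (T \<times> S)"
  proof (rule inj_onI, clarify)
    fix t s t' s' assume TS: "t \<in> T" "t' \<in> T" "s \<in> S" "s' \<in> S"
      and eq: "t \<otimes>\<^bsub>BijGroup \<Omega>\<^esub> inv\<^bsub>BijGroup \<Omega>\<^esub> s = t' \<otimes>\<^bsub>BijGroup \<Omega>\<^esub> inv\<^bsub>BijGroup \<Omega>\<^esub> s'"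
    have mem: "t \<in> G" "t' \<in> G" "s \<in> G" "s' \<in> G"
      using TS T SG by auto
    note c = mem [THEN carr]
    \<comment> \<open>The equation rearranges to equal quotients of \<open>t\<close>,
      \<open>t'\<close> and of \<open>s\<close>, \<open>s'\<close>. Since
      \<open>perms_intersect\<close> depends only on the quotient, the intersection of
      \<open>s\<close> with \<open>s'\<close> passes to \<open>t\<close> and \<open>t'\<close>,
      which must then coincide.\<close>
    have "inv\<^bsub>BijGroup \<Omega>\<^esub> t' \<otimes>\<^bsub>BijGroup \<Omega>\<^esub> (t \<otimes>\<^bsub>BijGroup \<Omega>\<^esub> inv\<^bsub>BijGroup \<Omega>\<^esub> s) \<otimes>\<^bsub>BijGroup \<Omega>\<^esub> s
      = inv\<^bsub>BijGroup \<Omega>\<^esub> t' \<otimes>\<^bsub>BijGroup \<Omega>\<^esub> (t' \<otimes>\<^bsub>BijGroup \<Omega>\<^esub> inv\<^bsub>BijGroup \<Omega>\<^esub> s') \<otimes>\<^bsub>BijGroup \<Omega>\<^esub> s"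
      using eq by simp
    then have eq': "inv\<^bsub>BijGroup \<Omega>\<^esub> t' \<otimes>\<^bsub>BijGroup \<Omega>\<^esub> t = inv\<^bsub>BijGroup \<Omega>\<^esub> s' \<otimes>\<^bsub>BijGroup \<Omega>\<^esub> s"
      using c by (simp add: B.m_assoc)
    have "perms_intersect \<Omega> s s'"
      using S TS by (simp add: intersecting_set_def)
    then have "perms_intersect \<Omega> t t'"
      by (simp add: perms_intersect_def eq')
    then have "t = t'"
      using intersect_iff mem T_eq TS by blast
    then have "inv\<^bsub>BijGroup \<Omega>\<^esub> s = inv\<^bsub>BijGroup \<Omega>\<^esub> s'"
      using eq c by simp
    then show "t = t' \<and> s = s'"
      using \<open>t = t'\<close> c by (metis B.inv_inv)
  qed
  have "?f ` (T \<times> S) \<subseteq> G"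
    using T SG G by (auto simp: subset_iff subgroup.m_closed subgroup.m_inv_closed)
  then have "card T * card S \<le> card G"
    using card_mono [OF finG, of "?f ` (T \<times> S)"] card_image [OF inj] by (simp add: card_cartesian_product)
  moreover have "card G = card \<Omega> * card (point_stabilizer \<Omega> G \<omega>)"
  proof -
    have "orbit (perm_group \<Omega> G) (\<lambda>g. g) \<omega> = \<Omega>"
      using unique_orbit [OF \<omega>] \<omega> element_image by (auto simp: orbit_def)
    then show ?thesis
      using orbit_stabilizer_theorem [OF \<omega>] by (simp add: order_def)
  qed
  \<comment> \<open>Combines \<open>card T * card S\<close> \<le> \<open>card G\<close> with the
    orbit-stabilizer equation; \<open>card \<Omega>\<close> is positive and cancels.\<close>
  ultimately have "card \<Omega> * card S \<le> card \<Omega> * card (point_stabilizer \<Omega> G \<omega>)"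
    using T(2) by (metis mult_le_mono1 order_trans)
  then show "card S \<le> card (point_stabilizer \<Omega> G \<omega>)"
    using assms(3,4) by (simp add: prime_gt_0_nat)
qed

end
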